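(* Fix an integer $n\ge 2$. Then there are uncountable sets $\Lambda_M\subset[2n+1,2n+3]$ and $\Lambda_{nM}\subset[2n+1,2n+3]$ such that for every $\lambda\in\Lambda_M$ the lifting $F_\lambda$ is Markov and for every $\lambda\in\Lambda_{nM}$ the lifting $F_\lambda$ is not Markov.
   Context: For a real parameter $\lambda\ge 2+\sqrt5$, let $F_\lambda:\mathbb{R}\to\mathbb{R}$ be the "connect the dots" map, whose graph consists of straight line segments connecting consecutive dots, with the dots $(k,k-1)$ and $(k+b,k+c)$ for $k\in\mathbb{Z}$, where $b=(\lambda+1)/(2\lambda)$ and $c=(\lambda-1)/2$. Thus $F_\lambda$ is continuous, $F_\lambda(x+1)=F_\lambda(x)+1$, $F_\lambda$ is affine with slope $\lambda$ on $[k,k+b]$ and with slope $-\lambda$ on $[k+b,k+1]$; it is a lifting of a continuous degree one circle map $f_\lambda:\mathbb{R}/\mathbb{Z}\to\mathbb{R}/\mathbb{Z}$. "Markov" means countably Markov: $F_\lambda$ is Markov if and only if, for the corresponding circle map $f_\lambda$, the trajectory $\{f_\lambda^i(z)\}_{i\ge0}$ of the local maximum $z=b \bmod 1$ has countable closure in $\mathbb{R}/\mathbb{Z}$ (the local minimum $0\bmod 1$ is always a fixed point of $f_\lambda$). *)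

theory Defs
  imports "HOL-Analysis.Analysis"
begin

text \<open>The circle \<open>\<real>/\<int>\<close> with the quotient topology.\<close>

quotient_type circle = real / "\<lambda>x y. x - y \<in> \<int>"
  morphisms rep_circle to_circle
proof (rule equivpI)
  show "reflp (\<lambda>x y :: real. x - y \<in> \<int>)"
    by (rule reflpI) simp
  show "symp (\<lambda>x y :: real. x - y \<in> \<int>)"
    by (rule sympI) (metis Ints_minus minus_diff_eq)
  show "transp (\<lambda>x y :: real. x - y \<in> \<int>)"
    by (rule transpI) (metis Ints_add diff_add_cancel add_diff_eq)
qed

instantiation circle :: topological_space
begin

definition open_circle :: "circle set \<Rightarrow> bool" where
  "open_circle U \<longleftrightarrow> open (to_circle -` U)"

instance
proof
  show "open (UNIV :: circle set)"
    by (simp add: open_circle_def)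
  show "open (S \<inter> T)" if "open S" "open T" for S T :: "circle set"
    using that by (simp add: open_circle_def open_Int)
  show "open (\<Union>K)" if "\<forall>S\<in>K. open S" for K :: "circle set set"
    using that by (auto simp: open_circle_def vimage_Union)
qed

end

definition peak :: "real \<Rightarrow> real" where
  "peak lam = (lam + 1) / (2 * lam)"

definition peak_height :: "real \<Rightarrow> real" where
  "peak_height lam = (lam - 1) / 2"

text \<open>
  With \<open>b = peak lam\<close> and \<open>c = peak_height lam\<close>, the segment from \<open>(k, k - 1)\<close> to
  \<open>(k + b, k + c)\<close> has slope \<open>(c + 1) / b = lam\<close> and the one from \<open>(k + b, k + c)\<close> to
  \<open>(k + 1, k)\<close> has slope \<open>- c / (1 - b) = - lam\<close>. For \<open>lam > 1\<close> we have \<open>0 < b < 1\<close>.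
\<close>

definition dots_map :: "real \<Rightarrow> real \<Rightarrow> real" where
  "dots_map lam x =
     (let k = of_int \<lfloor>x\<rfloor> in
      if x \<le> k + peak lam then (k - 1) + lam * (x - k)
      else (k + peak_height lam) - lam * (x - (k + peak lam)))"

lemma dots_map_add_int: "dots_map lam (x + of_int m) = dots_map lam x + of_int m"
  by (simp add: dots_map_def Let_def algebra_simps)

lemma peak_bounds: "0 < peak lam" "peak lam < 1" if "lam > 1"
  using that by (simp_all add: peak_def field_simps)

lemma dots_map_dots:
  assumes "lam > 1"
  shows "dots_map lam (of_int k) = of_int k - 1"
    and "dots_map lam (of_int k + peak lam) = of_int k + peak_height lam"
proof -
  have fl: "\<lfloor>of_int k + peak lam\<rfloor> = k"
    using peak_bounds[OF assms] by (simp add: floor_eq_iff)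
  have "lam * peak lam = peak_height lam + 1"
    using assms by (simp add: peak_def peak_height_def field_simps)
  then show "dots_map lam (of_int k + peak lam) = of_int k + peak_height lam"
    by (simp add: dots_map_def Let_def fl)
  show "dots_map lam (of_int k) = of_int k - 1"
    using peak_bounds[OF assms] by (simp add: dots_map_def Let_def)
qed

lemma dots_map_rising:
  assumes "lam > 1" "of_int k \<le> x" "x \<le> of_int k + peak lam"
  shows "dots_map lam x = (of_int k - 1) + lam * (x - of_int k)"
proof -
  have "\<lfloor>x\<rfloor> = k"
    using peak_bounds[OF assms(1)] assms by (simp add: floor_eq_iff)
  then show ?thesis
    using assms by (simp add: dots_map_def Let_def)
qed

lemma dots_map_falling:
  assumes "lam > 1" "of_int k + peak lam \<le> x" "x \<le> of_int k + 1"
  shows "dots_map lam x = (of_int k + peak_height lam) - lam * (x - (of_int k + peak lam))"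
proof -
  consider "x = of_int k + peak lam" | "x = of_int (k + 1)"
    | "of_int k + peak lam < x" "x < of_int k + 1"
    using assms by fastforce
  then show ?thesis
  proof cases
    case 1
    then show ?thesis
      using dots_map_dots(2)[OF assms(1)] by simp
  next
    case 2
    have "lam * (1 - peak lam) = peak_height lam"
      using assms(1) by (simp add: peak_def peak_height_def field_simps)
    then show ?thesis
      unfolding 2 dots_map_dots(1)[OF assms(1)] by (simp add: algebra_simps)
  next
    case 3
    then have "\<lfloor>x\<rfloor> = k"
      using peak_bounds[OF assms(1)] by (simp add: floor_eq_iff)
    then show ?thesis
      using 3 by (simp add: dots_map_def Let_def)
  qed
qed

lift_definition circle_map :: "real \<Rightarrow> circle \<Rightarrow> circle" is dots_map
proof -
  fix lam x y :: real
  assume "x - y \<in> \<int>"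
  then obtain m where "x - y = of_int m"
    by (auto elim: Ints_cases)
  then have "x = y + of_int m"
    by simp
  then show "dots_map lam x - dots_map lam y \<in> \<int>"
    by (simp add: dots_map_add_int)
qed

lemma circle_map_fixed:
  assumes "lam > 1"
  shows "circle_map lam (to_circle 0) = to_circle 0"
  using dots_map_dots(1)[OF assms, of 0]
  by (simp add: circle_map.abs_eq circle.abs_eq_iff)

text \<open>
  Countably Markov. The lifting \<^term>\<open>dots_map lam\<close> is Markov iff the orbit of the turning point
  \<open>peak lam mod 1\<close> has countable closure in the circle; the other turning point,
  \<open>0 mod 1\<close>, is fixed and so imposes no condition.
\<close>

definition Markov :: "real \<Rightarrow> bool" where
  "Markov lam \<longleftrightarrow>
     countable (closure (range (\<lambda>i. (circle_map lam ^^ i) (to_circle (peak lam)))))"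

end

theory Submission
  imports Defs "HOL-Library.Nat_Bijection"
begin

text \<open>
  On the rising branch \<open>f\<close> is \<open>x \<mapsto> lam x mod 1\<close>, and the peak is mapped to
  \<open>(lam - 1) / 2 mod 1\<close>. For every 0-1 sequence \<open>a\<close>, the intermediate value theorem gives a
  \<open>lam\<close> for which this image is the number with base-\<open>lam\<close> expansion \<open>0.a\<^sub>0a\<^sub>1a\<^sub>2\<dots>\<close>. As
  \<open>lam \<ge> 5\<close>, numbers with 0-1 expansions lie in \<open>[0, 1/4]\<close>, well inside the rising branch, so the
  orbit just shifts the expansion; distinct sequences have distinct values and hence
  distinct \<open>lam\<close>. If all ones of \<open>a\<close> sit at powers of two, the shifts of \<open>a\<close>
  accumulate only at sequences with at most one 1, and the orbit closure is countable. If
  instead \<open>a\<close> contains every finite word, the orbit closure contains all 0-1 expansions. Both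
  kinds of sequences leave one free bit at every power of two.
\<close>

section \<open>Expansions with digits 0 and 1\<close>

text \<open>A 0-1 sequence is encoded as the set of positions of its ones, and the base \<open>lam\<close> enters
  through \<open>q = 1 / lam\<close>.\<close>

definition expansion :: "real \<Rightarrow> nat set \<Rightarrow> real" where
  "expansion q A = (\<Sum>j. of_bool (j \<in> A) * q ^ Suc j)"

definition shift :: "nat \<Rightarrow> nat set \<Rightarrow> nat set" where
  "shift k A = {j. k + j \<in> A}"

lemma mem_shift_iff [simp]: "j \<in> shift k A \<longleftrightarrow> k + j \<in> A"
  by (simp add: shift_def)

lemma shift_0 [simp]: "shift 0 A = A"
  by (simp add: shift_def)

lemma shift_shift [simp]: "shift k (shift l A) = shift (l + k) A"
  by (simp add: shift_def add.assoc)

lemma summable_digits: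
  fixes q :: real
  assumes "0 \<le> q" "q < 1"
  shows "summable (\<lambda>j. of_bool (j \<in> A) * q ^ j)"
  by (rule summable_comparison_test'[OF summable_geometric[of q], of 0]) (use assms in auto)

lemma summable_expansion:
  fixes q :: real
  assumes "0 \<le> q" "q < 1"
  shows "summable (\<lambda>j. of_bool (j \<in> A) * q ^ Suc j)"
  using summable_mult[OF summable_digits[OF assms], of q A] by (simp add: mult_ac)

lemma expansion_altdef:
  assumes "0 \<le> q" "q < 1"
  shows "expansion q A = q * (\<Sum>j. of_bool (j \<in> A) * q ^ j)"
  unfolding expansion_def suminf_mult[OF summable_digits[OF assms], symmetric]
  by (simp add: mult_ac)

lemma expansion_bounds:
  assumes "0 \<le> q" "q \<le> 1 / 5"
  shows "0 \<le> expansion q A" "expansion q A \<le> 1 / 4"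
proof -
  have q: "q < 1" using assms by simp
  show "0 \<le> expansion q A"
    unfolding expansion_def
    by (rule suminf_nonneg[OF summable_expansion]) (use assms q in auto)
  have "(\<Sum>j. of_bool (j \<in> A) * q ^ j) \<le> (\<Sum>j. q ^ j)"
    by (rule suminf_le) (use assms q in \<open>auto intro: summable_digits summable_geometric\<close>)
  also have "\<dots> = 1 / (1 - q)"
    by (rule suminf_geometric) (use assms q in auto)
  finally have "expansion q A \<le> q * (1 / (1 - q))"
    unfolding expansion_altdef[OF assms(1) q] using assms(1) by (rule mult_left_mono)
  also have "\<dots> \<le> 1 / 4" using assms by (simp add: field_simps)
  finally show "expansion q A \<le> 1 / 4" .
qed

lemma expansion_rec:
  assumes "0 \<le> q" "q < 1"
  shows "expansion q A = q * (of_bool (0 \<in> A) + expansion q (shift 1 A))"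
proof -
  have "(\<Sum>j. of_bool (j \<in> A) * q ^ j)
      = of_bool (0 \<in> A) + (\<Sum>j. of_bool (Suc j \<in> A) * q ^ Suc j)"
    using suminf_split_head[OF summable_digits[OF assms, of A]] by simp
  then show ?thesis
    unfolding expansion_altdef[OF assms, of A] by (simp add: expansion_def)
qed

text \<open>Each common leading digit cancels in \<open>expansion_rec\<close> and leaves a factor
  \<open>q\<close>. After \<open>L\<close> digits the remaining values both lie in [0, 1/4], hence
  differ by at most 1.\<close>

lemma expansion_cong_prefix:
  assumes "0 \<le> q" "q \<le> 1 / 5" "A \<inter> {..<L} = B \<inter> {..<L}"
  shows "\<bar>expansion q A - expansion q B\<bar> \<le> q ^ L"
  using assms(3)
proof (induction L arbitrary: A B)
  case 0
  then show ?case
    using expansion_bounds[OF assms(1,2), of A] expansion_bounds[OF assms(1,2), of B] by simp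
next
  case (Suc L)
  have digits: "j \<in> A \<longleftrightarrow> j \<in> B" if "j < Suc L" for j
    using Suc.prems that by auto
  have "shift 1 A \<inter> {..<L} = shift 1 B \<inter> {..<L}"
    using digits by auto
  then have "\<bar>expansion q (shift 1 A) - expansion q (shift 1 B)\<bar> \<le> q ^ L"
    by (rule Suc.IH)
  then have "q * \<bar>expansion q (shift 1 A) - expansion q (shift 1 B)\<bar> \<le> q * q ^ L"
    using assms(1) by (rule mult_left_mono)
  moreover have "expansion q A - expansion q B
      = q * (expansion q (shift 1 A) - expansion q (shift 1 B))"
    using expansion_rec[of q A] expansion_rec[of q B] digits[of 0] assms
    by (simp add: algebra_simps)
  ultimately show ?case
    using assms(1) by (simp add: abs_mult)
qed

text \<open>Tails lie in [0, 1/4], so digit plus tail determines the digit; the tails then agree as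
  well, and repeated shifting recovers all digits.\<close>

lemma expansion_inject:
  assumes "0 < q" "q \<le> 1 / 5" "expansion q A = expansion q B"
  shows "A = B"
proof -
  have step: "(0 \<in> A \<longleftrightarrow> 0 \<in> B) \<and> expansion q (shift 1 A) = expansion q (shift 1 B)"
    if "expansion q A = expansion q B" for A B
  proof -
    have "of_bool (0 \<in> A) + expansion q (shift 1 A) = of_bool (0 \<in> B) + expansion q (shift 1 B)"
      using that expansion_rec[of q A] expansion_rec[of q B] assms(1,2) by simp
    then show ?thesis
      using expansion_bounds[of q "shift 1 A"] expansion_bounds[of q "shift 1 B"] assms(1,2)
      by (cases "0 \<in> A"; cases "0 \<in> B") auto
  qed
  have "expansion q (shift k A) = expansion q (shift k B)" for k
  proof (induction k)
    case 0
    show ?case using assms(3) by simp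
  next
    case (Suc k)
    then show ?case using step[of "shift k A" "shift k B"] by simp
  qed
  then have "k \<in> A \<longleftrightarrow> k \<in> B" for k
    using step[of "shift k A" "shift k B"] by simp
  then show ?thesis by blast
qed

lemma expansion_empty [simp]: "expansion q {} = 0"
  by (simp add: expansion_def)

lemma expansion_singleton [simp]: "expansion q {j} = q ^ Suc j"
proof -
  have "(\<lambda>i. of_bool (i \<in> {j}) * q ^ Suc i) sums (\<Sum>i\<in>{j}. of_bool (i \<in> {j}) * q ^ Suc i)"
    by (rule sums_finite) auto
  then show ?thesis
    by (simp add: expansion_def sums_iff)
qed

lemma isCont_digit_series:
  fixes q :: real
  assumes "0 \<le> q" "q < 1 / 2"
  shows "isCont (\<lambda>q. \<Sum>j. of_bool (j \<in> A) * q ^ j) q"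
  by (rule isCont_powser[where K = "1 / 2"]) (use assms summable_digits[of "1 / 2"] in auto)

section \<open>Choice of the slope\<close>

text \<open>The difference of the two sides is at most 0 at \<open>a\<close> and at least 3/4 at
  \<open>a + 2\<close>, so it vanishes in between.\<close>

lemma exists_slope:
  fixes a :: real
  assumes "a \<ge> 5"
  obtains lam where "a \<le> lam" "lam \<le> a + 2" "(lam - a) / 2 = expansion (1 / lam) A"
proof -
  \<comment> \<open>Writing out the power series makes continuity in \<open>lam\<close> available;
    by \<open>expansion_altdef\<close> it is the expansion for \<open>lam\<close> \<ge>
    \<open>a\<close>.\<close>
  define g where "g lam = (lam - a) / 2 - (1 / lam) * (\<Sum>j. of_bool (j \<in> A) * (1 / lam) ^ j)"
    for lam
  have g: "g lam = (lam - a) / 2 - expansion (1 / lam) A" if "lam \<ge> a" for lam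
    unfolding g_def by (subst expansion_altdef) (use that assms in auto)
  have bounds: "0 \<le> expansion (1 / lam) A" "expansion (1 / lam) A \<le> 1 / 4" if "lam \<ge> a" for lam
    using expansion_bounds[of "1 / lam" A] that assms by (auto simp: field_simps)
  have "isCont g lam" if "lam \<ge> a" for lam
  proof -
    have "isCont (\<lambda>lam. \<Sum>j. of_bool (j \<in> A) * (1 / lam) ^ j) lam"
      by (rule isCont_o2[OF _ isCont_digit_series])
        (use that assms in \<open>auto intro!: continuous_intros simp: field_simps\<close>)
    then show ?thesis
      unfolding g_def using that assms by (auto intro!: continuous_intros)
  qed
  then have "\<exists>lam\<ge>a. lam \<le> a + 2 \<and> g lam = 0"
    by (intro IVT) (use g[of a] g[of "a + 2"] bounds[of a] bounds[of "a + 2"] in auto)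
  then show ?thesis
    using g that by force
qed

section \<open>The circle\<close>

lemma to_circle_eq_iff: "to_circle x = to_circle y \<longleftrightarrow> x - y \<in> \<int>"
  by (simp add: circle.abs_eq_iff)

lemma continuous_on_to_circle: "continuous_on S to_circle"
proof -
  have "continuous_on UNIV to_circle"
    by (simp add: continuous_on_open_vimage open_circle_def[abs_def] open_circle_def)
  then show ?thesis
    by (rule continuous_on_subset) simp
qed

text \<open>The preimage of the image is the sum of the closed set of integers and the compact
  \<open>K\<close>, hence closed.\<close>

lemma closed_to_circle_image:
  assumes "compact K"
  shows "closed (to_circle ` K)"
proof -
  have "to_circle -` (to_circle ` K) = (\<Union>x\<in>\<int>. \<Union>y\<in>K. {x + y})"
  proof (intro set_eqI iffI)
    fix z
    assume "z \<in> to_circle -` (to_circle ` K)"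
    then obtain y where "y \<in> K" "z - y \<in> \<int>"
      by (auto simp: to_circle_eq_iff)
    then show "z \<in> (\<Union>x\<in>\<int>. \<Union>y\<in>K. {x + y})"
      by (intro UN_I[of "z - y"] UN_I[of y]) auto
  next
    fix z
    assume "z \<in> (\<Union>x\<in>\<int>. \<Union>y\<in>K. {x + y})"
    then obtain x y where "x \<in> \<int>" "y \<in> K" "z = x + y"
      by auto
    then show "z \<in> to_circle -` (to_circle ` K)"
      by (auto simp: to_circle_eq_iff intro!: rev_image_eqI[of y])
  qed
  moreover have "closed (\<Union>x\<in>(\<int> :: real set). \<Union>y\<in>K. {x + y})"
    by (rule closed_compact_sums) (use assms in auto)
  ultimately show ?thesis
    by (simp add: closed_def open_circle_def[abs_def] open_circle_def vimage_Compl)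
qed

lemma inj_on_to_circle: "inj_on to_circle {0..<1}"
proof (rule inj_onI)
  fix x y
  assume xy: "x \<in> {0..<1}" "y \<in> {0..<1}" "to_circle x = to_circle y"
  then obtain m where "x - y = of_int m"
    by (auto simp: to_circle_eq_iff elim: Ints_cases)
  moreover from this have "-1 < m" "m < 1"
    using xy by auto
  ultimately show "x = y" by auto
qed

section \<open>The orbit of the peak\<close>

text \<open>The left side of \<open>code\<close> is \<open>peak_height lam - n\<close>, so modulo 1
  the image of the peak is the expansion coded by \<open>A\<close>.\<close>

locale coded_slope =
  fixes lam :: real and n :: nat and A :: "nat set"
  assumes lam_ge: "lam \<ge> 5"
    and code: "(lam - (2 * real n + 1)) / 2 = expansion (1 / lam) A"
begin

definition x :: "nat \<Rightarrow> real" where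
  "x k = expansion (1 / lam) (shift k A)"

lemma base_bounds: "0 < 1 / lam" "1 / lam \<le> 1 / 5"
  using lam_ge by (auto simp: field_simps)

lemma x_bounds: "0 \<le> x k" "x k \<le> 1 / 4"
  unfolding x_def using expansion_bounds base_bounds by (simp_all add: less_imp_le)

lemma circle_map_x: "circle_map lam (to_circle (x k)) = to_circle (x (Suc k))"
proof -
  have "1 / 2 \<le> peak lam"
    using lam_ge by (simp add: peak_def field_simps)
  then have "dots_map lam (x k) = lam * x k - 1"
    using dots_map_rising[of lam 0 "x k"] x_bounds[of k] lam_ge by simp
  also have "lam * x k = of_bool (k \<in> A) + x (Suc k)"
    unfolding x_def using expansion_rec[of "1 / lam" "shift k A"] lam_ge by simp
  finally show ?thesis
    by (simp add: circle_map.abs_eq to_circle_eq_iff)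
qed

lemma circle_map_peak: "circle_map lam (to_circle (peak lam)) = to_circle (x 0)"
proof -
  have "dots_map lam (peak lam) = peak_height lam"
    using dots_map_dots(2)[of lam 0] lam_ge by simp
  moreover have "peak_height lam - x 0 = real n"
    using code by (simp add: x_def peak_height_def field_simps)
  ultimately show ?thesis
    by (simp add: circle_map.abs_eq to_circle_eq_iff)
qed

text \<open>The index is off by one because the coding starts at the image of the peak; the peak
  itself, being at least 1/2, has no 0-1 expansion.\<close>

lemma orbit_Suc: "(circle_map lam ^^ Suc k) (to_circle (peak lam)) = to_circle (x k)"
  by (induction k) (simp_all add: circle_map_peak circle_map_x)

lemma orbit: "range (\<lambda>i. (circle_map lam ^^ i) (to_circle (peak lam)))
    = to_circle ` insert (peak lam) (range x)"
proof -
  have "range (\<lambda>i. (circle_map lam ^^ i) (to_circle (peak lam)))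
      = insert (to_circle (peak lam)) ((\<lambda>k. (circle_map lam ^^ Suc k) (to_circle (peak lam))) ` UNIV)"
    by (subst UNIV_nat_eq) (auto simp: image_image)
  then show ?thesis
    by (simp only: orbit_Suc) auto
qed

lemma Markov_if_countable_closed:
  assumes "closed K" "countable K" "range x \<subseteq> K"
  shows "Markov lam"
proof -
  \<comment> \<open>Cutting \<open>K\<close> down to [0, 1] gives compactness, and so a closed image
    in the circle, without losing any \<open>x k\<close>.\<close>
  define K' where "K' = insert (peak lam) (K \<inter> {0..1})"
  have "compact K'"
    unfolding K'_def by (intro compact_insert closed_Int_compact assms(1)) simp
  moreover have "insert (peak lam) (range x) \<subseteq> K'"
  proof -
    have "x k \<in> K \<inter> {0..1}" for k
      using assms(3) x_bounds[of k] by auto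
    then show ?thesis
      unfolding K'_def by auto
  qed
  ultimately have "closure (to_circle ` insert (peak lam) (range x)) \<subseteq> to_circle ` K'"
    by (intro closure_minimal closed_to_circle_image image_mono)
  moreover have "countable (to_circle ` K')"
    using assms(2) unfolding K'_def by (intro countable_image) auto
  ultimately show ?thesis
    unfolding Markov_def orbit by (rule countable_subset)
qed

lemma not_Markov_if_uncountable_closure:
  assumes "uncountable (closure (range x))"
  shows "\<not> Markov lam"
proof
  assume "Markov lam"
  have "to_circle ` closure (range x) \<subseteq> closure (to_circle ` insert (peak lam) (range x))"
    by (intro image_closure_subset continuous_on_to_circle closed_closure
        order_trans[OF _ closure_subset] image_mono) auto
  then have "countable (to_circle ` closure (range x))"
    using \<open>Markov lam\<close> unfolding Markov_def orbit by (rule countable_subset)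
  moreover have "closure (range x) \<subseteq> {0..1 / 4}"
    by (rule closure_minimal) (use x_bounds in auto)
  then have "inj_on to_circle (closure (range x))"
    by (intro inj_on_subset[OF inj_on_to_circle]) force
  ultimately show False
    using assms countable_image_inj_on by blast
qed

end

section \<open>Sparse sequences\<close>

text \<open>A point of the closure of the range outside \<open>L\<close> has positive distance from
  \<open>L\<close>, while the tail of \<open>x\<close> approaches \<open>L\<close>. So only finitely
  many terms can come near the point, and it is one of them.\<close>

lemma closed_range_Un:
  fixes x l :: "nat \<Rightarrow> 'a :: metric_space"
  assumes "closed L" "\<And>k. l k \<in> L" "(\<lambda>k. dist (x k) (l k)) \<longlonglongrightarrow> 0"
  shows "closed (range x \<union> L)"
proof -
  have "y \<in> range x" if y: "y \<in> closure (range x)" "y \<notin> L" for y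
  proof -
    obtain e where e: "e > 0" "\<And>z. z \<in> L \<Longrightarrow> e \<le> dist y z"
      using assms(1) y(2) by (metis closed_def ComplI ComplD open_dist dist_commute not_less)
    obtain N where N: "\<And>k. k \<ge> N \<Longrightarrow> dist (x k) (l k) < e / 2"
      using order_tendstoD(2)[OF assms(3), of "e / 2"] e(1)
      by (auto simp: eventually_sequentially)
    have "range x = x ` {..<N} \<union> x ` {N..}"
      by (auto simp flip: image_Un simp: ivl_disj_un)
    then have "closure (range x) = x ` {..<N} \<union> closure (x ` {N..})"
      by (simp add: closure_closed finite_imp_closed)
    moreover have "y \<notin> closure (x ` {N..})"
    proof
      assume "y \<in> closure (x ` {N..})"
      then have "\<exists>z\<in>x ` {N..}. dist z y < e / 2"
        using half_gt_zero[OF e(1)] unfolding closure_approachable by blast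
      then obtain k where "k \<ge> N" "dist (x k) y < e / 2"
        by auto
      then show False
        using N[of k] e(2)[OF assms(2)[of k]] dist_triangle[of y "l k" "x k"]
        by (simp add: dist_commute)
    qed
    ultimately show ?thesis
      using y(1) by blast
  qed
  then have "closure (range x \<union> L) \<subseteq> range x \<union> L"
    using assms(1) by auto
  then show ?thesis
    using closure_subset_eq by blast
qed

lemma power2_close_unique:
  fixes a b :: nat
  assumes "(2::nat) ^ a < 2 * 2 ^ b" "(2::nat) ^ b < 2 * 2 ^ a"
  shows "a = b"
proof -
  have "(2::nat) ^ a < 2 ^ Suc b" "(2::nat) ^ b < 2 ^ Suc a"
    using assms by simp_all
  then have "a < Suc b" "b < Suc a"
    by (simp_all only: power_strict_increasing_iff one_less_numeral_iff semiring_norm)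
  then show ?thesis by simp
qed

text \<open>The window from \<open>k\<close> to \<open>2 * k - 1\<close> holds at most one power of
  two. Hence \<open>x k\<close> is within \<open>q ^ k\<close> of an expansion with at most one 1,
  and these form the countable closed set \<open>L\<close>.\<close>

lemma (in coded_slope) Markov_sparse:
  assumes "A \<subseteq> range (\<lambda>k. 2 ^ k)"
  shows "Markov lam"
proof -
  define q where "q = 1 / lam"
  define L where "L = insert 0 (range (\<lambda>j. q ^ Suc j))"
  have q: "0 < q" "q \<le> 1 / 5"
    using base_bounds by (auto simp: q_def)
  have "\<exists>y\<in>L. \<bar>x k - y\<bar> \<le> q ^ k" for k
  proof -
    define B where "B = shift k A \<inter> {..<k}"
    have "i = j" if "i \<in> B" "j \<in> B" for i j
    proof -
      have ij: "k + i \<in> A" "k + j \<in> A" "i < k" "j < k"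
        using that by (auto simp: B_def)
      then obtain a b where ab: "k + i = 2 ^ a" "k + j = 2 ^ b"
        using assms by blast
      have "a = b"
        \<comment> \<open>Both positions lie in the window, so each is less than twice the
          other.\<close>
        by (rule power2_close_unique) (use ij ab in linarith)+
      with ab show ?thesis by simp
    qed
    then have "B = {} \<or> (\<exists>j. B = {j})"
      by blast
    then have "expansion q B \<in> L"
      by (auto simp: L_def)
    moreover have "\<bar>expansion q (shift k A) - expansion q B\<bar> \<le> q ^ k"
      by (rule expansion_cong_prefix) (use q in \<open>auto simp: B_def\<close>)
    ultimately show ?thesis
      by (auto simp: x_def q_def)
  qed
  then obtain l where l: "\<And>k. l k \<in> L" "\<And>k. \<bar>x k - l k\<bar> \<le> q ^ k"
    by metis
  have "(\<lambda>k. q ^ k) \<longlonglongrightarrow> 0"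
    by (rule LIMSEQ_power_zero) (use q in auto)
  then have "(\<lambda>k. dist (x k) (l k)) \<longlonglongrightarrow> 0"
    by (rule Lim_null_comparison[rotated]) (use l(2) in \<open>auto simp: dist_real_def\<close>)
  moreover have "closed L"
    unfolding L_def
    by (intro compact_imp_closed compact_sequence_with_limit LIMSEQ_Suc) fact
  ultimately have "closed (range x \<union> L)"
    using l(1) by (intro closed_range_Un)
  then show ?thesis
    by (rule Markov_if_countable_closed) (auto simp: L_def)
qed

section \<open>Universal sequences\<close>

definition contains_all_words :: "nat set \<Rightarrow> bool" where
  "contains_all_words A \<longleftrightarrow> (\<forall>W L. \<exists>k. shift k A \<inter> {..<L} = W \<inter> {..<L})"

lemma uncountable_UNIV_nat_set: "uncountable (UNIV :: nat set set)"
proof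
  assume "countable (UNIV :: nat set set)"
  then have "range (from_nat_into (UNIV :: nat set set)) = UNIV"
    by (intro range_from_nat_into) auto
  then show False
    using Cantors_theorem[of "UNIV :: nat set"] by auto
qed

text \<open>A shift of \<open>A\<close> that starts with the first \<open>L\<close> digits of
  \<open>W\<close> puts an orbit point within \<open>(1 / lam) ^ L\<close> of the expansion of
  \<open>W\<close>.\<close>

lemma (in coded_slope) not_Markov_universal:
  assumes "contains_all_words A"
  shows "\<not> Markov lam"
proof -
  have q: "0 \<le> 1 / lam" "1 / lam \<le> 1 / 5"
    using base_bounds by simp_all
  have "expansion (1 / lam) W \<in> closure (range x)" for W
    unfolding closure_approachable
  proof (intro allI impI)
    fix e :: real
    assume "e > 0"
    then obtain L where L: "(1 / lam) ^ L < e"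
      using real_arch_pow_inv[of e "1 / lam"] q by auto
    obtain k where "shift k A \<inter> {..<L} = W \<inter> {..<L}"
      using assms unfolding contains_all_words_def by blast
    then have "\<bar>x k - expansion (1 / lam) W\<bar> \<le> (1 / lam) ^ L"
      unfolding x_def by (intro expansion_cong_prefix q)
    then show "\<exists>y\<in>range x. dist y (expansion (1 / lam) W) < e"
      using L by (intro bexI[of _ "x k"]) (auto simp: dist_real_def)
  qed
  then have "range (expansion (1 / lam)) \<subseteq> closure (range x)"
    by auto
  moreover have "inj (expansion (1 / lam))"
    using expansion_inject base_bounds by (intro injI)
  then have "uncountable (range (expansion (1 / lam)))"
    using countable_image_inj_on uncountable_UNIV_nat_set by blast
  ultimately show ?thesis
    using not_Markov_if_uncountable_closure countable_subset by blast
qed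

text \<open>The positions strictly between \<open>2 ^ k\<close> and \<open>2 ^ Suc k\<close> carry the binary digits of \<open>k\<close>, least
  significant first.\<close>

definition universal_code :: "nat set \<Rightarrow> nat set" where
  "universal_code S = (\<lambda>k. 2 ^ k) ` S \<union>
     {2 ^ k + Suc i | k i. Suc i < 2 ^ k \<and> i \<in> set_decode k}"

lemma dyadic_block_unique:
  fixes k l r s :: nat
  assumes "2 ^ k + r = 2 ^ l + s" "r < 2 ^ k" "s < 2 ^ l"
  shows "k = l" "r = s"
proof -
  show "k = l"
    by (rule power2_close_unique) (use assms in linarith)+
  with assms show "r = s" by simp
qed

text \<open>Digits inside a block sit at a positive offset from its power of two, so they never
  interfere with the free bits; this makes \<open>universal_code\<close> injective.\<close>

lemma power2_mem_universal_code: "2 ^ k \<in> universal_code S \<longleftrightarrow> k \<in> S"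
proof -
  have "2 ^ k \<noteq> 2 ^ l + Suc i" if "Suc i < 2 ^ l" for l i
    using dyadic_block_unique(2)[of k 0 l "Suc i"] that by auto
  then show ?thesis
    by (auto simp: universal_code_def simp del: add_Suc_right)
qed

lemma block_mem_universal_code:
  assumes "Suc i < 2 ^ k"
  shows "2 ^ k + Suc i \<in> universal_code S \<longleftrightarrow> i \<in> set_decode k"
proof -
  have "2 ^ k + Suc i \<noteq> 2 ^ l" for l
    using dyadic_block_unique[of k "Suc i" l 0] assms by auto
  moreover have "k = l \<and> i = j" if "2 ^ k + Suc i = 2 ^ l + Suc j" "Suc j < 2 ^ l" for l j
    using dyadic_block_unique[OF that(1) assms that(2)] by simp
  ultimately show ?thesis
    using assms unfolding universal_code_def by blast
qed

lemma contains_all_words_universal_code: "contains_all_words (universal_code S)"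
  unfolding contains_all_words_def
proof (intro allI)
  fix W :: "nat set" and L :: nat
  \<comment> \<open>The extra digit at position \<open>L\<close> makes \<open>k\<close> large enough for block \<open>k\<close> to have room for \<open>L\<close> digits.\<close>
  define k where "k = set_encode (insert L (W \<inter> {..<L}))"
  have "L < k"
    using less_exp[of L] by (simp add: k_def trans_less_add1)
  then have k: "Suc i < 2 ^ k" if "i < L" for i
    using that less_exp[of k] by linarith
  have "set_decode k = insert L (W \<inter> {..<L})"
    unfolding k_def by (rule set_encode_inverse) simp
  \<comment> \<open>The offset 1 skips the free bit at \<open>2 ^ k\<close>.\<close>
  then have "i \<in> shift (2 ^ k + 1) (universal_code S) \<longleftrightarrow> i \<in> W" if "i < L" for i
    using block_mem_universal_code[OF k[OF that], of S] that by simp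
  then show "\<exists>k. shift k (universal_code S) \<inter> {..<L} = W \<inter> {..<L}"
    by (intro exI[of _ "2 ^ k + 1"]) auto
qed

section \<open>Uncountably many slopes\<close>

lemma uncountable_slopes:
  fixes n :: nat and code :: "nat set \<Rightarrow> nat set"
  assumes "n \<ge> 2" "inj code"
  obtains \<Lambda> where "\<Lambda> \<subseteq> {2 * real n + 1 .. 2 * real n + 3}" "uncountable \<Lambda>"
    "\<And>lam. lam \<in> \<Lambda> \<Longrightarrow> \<exists>S. coded_slope lam n (code S)"
proof -
  have "\<exists>lam\<in>{2 * real n + 1 .. 2 * real n + 3}.
      (lam - (2 * real n + 1)) / 2 = expansion (1 / lam) (code S)" for S
    using exists_slope[of "2 * real n + 1" "code S"] assms(1) by force
  then obtain slope where slope: "\<And>S. slope S \<in> {2 * real n + 1 .. 2 * real n + 3}"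
    "\<And>S. (slope S - (2 * real n + 1)) / 2 = expansion (1 / slope S) (code S)"
    by metis
  have ge: "slope S \<ge> 5" for S
    using slope(1)[of S] assms(1) by simp
  \<comment> \<open>Equal slopes mean equal bases and equal expansion values, so the codes
    agree.\<close>
  have "inj slope"
  proof (rule injI)
    fix S T
    assume "slope S = slope T"
    then have "expansion (1 / slope S) (code S) = expansion (1 / slope S) (code T)"
      using slope(2) by metis
    then have "code S = code T"
      by (rule expansion_inject[rotated 2]) (use ge[of S] in \<open>auto simp: field_simps\<close>)
    then show "S = T"
      using assms(2) by (simp add: inj_eq)
  qed
  then have "uncountable (range slope)"
    using countable_image_inj_on uncountable_UNIV_nat_set by blast
  moreover have "coded_slope (slope S) n (code S)" for S
    by unfold_locales (fact ge slope(2))+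
  ultimately show ?thesis
    using slope(1) that[of "range slope"] by blast
qed

theorem theorem6p2:
  fixes n :: nat
  assumes "n \<ge> 2"
  shows "\<exists>\<Lambda>\<^sub>M \<Lambda>\<^sub>n\<^sub>M :: real set.
           \<Lambda>\<^sub>M \<subseteq> {2 * real n + 1 .. 2 * real n + 3} \<and>
           \<Lambda>\<^sub>n\<^sub>M \<subseteq> {2 * real n + 1 .. 2 * real n + 3} \<and>
           uncountable \<Lambda>\<^sub>M \<and> uncountable \<Lambda>\<^sub>n\<^sub>M \<and>
           (\<forall>lam\<in>\<Lambda>\<^sub>M. Markov lam) \<and>
           (\<forall>lam\<in>\<Lambda>\<^sub>n\<^sub>M. \<not> Markov lam)"
proof -
  have "inj (\<lambda>S :: nat set. (\<lambda>k. 2 ^ k :: nat) ` S)"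
    by (intro injI) (simp add: inj_image_eq_iff inj_def)
  with assms obtain \<Lambda>\<^sub>M where M: "\<Lambda>\<^sub>M \<subseteq> {2 * real n + 1 .. 2 * real n + 3}" "uncountable \<Lambda>\<^sub>M"
    "\<And>lam. lam \<in> \<Lambda>\<^sub>M \<Longrightarrow> \<exists>S. coded_slope lam n ((\<lambda>k. 2 ^ k) ` S)"
    by (rule uncountable_slopes) blast
  have "inj universal_code"
    by (intro injI set_eqI) (metis power2_mem_universal_code)
  with assms obtain \<Lambda>\<^sub>n\<^sub>M where nM: "\<Lambda>\<^sub>n\<^sub>M \<subseteq> {2 * real n + 1 .. 2 * real n + 3}"
    "uncountable \<Lambda>\<^sub>n\<^sub>M" "\<And>lam. lam \<in> \<Lambda>\<^sub>n\<^sub>M \<Longrightarrow> \<exists>S. coded_slope lam n (universal_code S)"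
    by (rule uncountable_slopes) blast
  have "Markov lam" if "lam \<in> \<Lambda>\<^sub>M" for lam
    using M(3)[OF that] coded_slope.Markov_sparse by blast
  moreover have "\<not> Markov lam" if "lam \<in> \<Lambda>\<^sub>n\<^sub>M" for lam
    using nM(3)[OF that] coded_slope.not_Markov_universal contains_all_words_universal_code by blast
  ultimately show ?thesis
    using M(1,2) nM(1,2) by blast
qed

end
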